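(* Let $\gamma:[0,L]\to\mathbb{R}^2$ be a smooth curve parametrized by arc length whose $\infty$-jets at $t=0$ and $t=L$ coincide with the $\infty$-jets of the $x$-axis (oriented to the right) at the points $(0,0)$ and $(1,0)$, respectively. Let $\Gamma=T(\gamma)=\gamma+\gamma'$. Assume that $Z(\gamma)$ is finite. Then $Z(\Gamma)>Z(\gamma)$.
   Context: The condition on $\infty$-jets means: $\gamma(0)=(0,0)$, $\gamma(L)=(1,0)$, $\gamma'(0)=\gamma'(L)=(1,0)$, and all derivatives of $\gamma$ of order $\ge2$ vanish at $t=0$ and $t=L$. The curve $\Gamma(t)=\gamma(t)+\gamma'(t)$, $t\in[0,L]$, is the locus of endpoints of the unit tangent segments to $\gamma$ (the front wheel track of a bicycle of length $1$ with rear wheel track $\gamma$); it is a smooth curve tangent to the $x$-axis to all orders at its endpoints $(1,0)$ and $(2,0)$. For such a curve, $Z$ denotes the number of its intersection points with the $x$-axis, endpoints excluded, counted by parameter: $Z(\gamma)$ is the number of $t\in(0,L)$ with $\gamma(t)$ on the $x$-axis, and $Z(\Gamma)$ is the number of $t\in(0,L)$ with $\Gamma(t)$ on the $x$-axis (a value of $+\infty$ is regarded as greater than any finite value). *)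

theory Defs
  imports "HOL-Analysis.Analysis" "HOL-Library.Extended_Nat"
begin

text \<open>
  Derivatives are taken within \<open>S\<close>; for \<open>S = {0..L}\<close> they are therefore one-sided at the
  endpoints. \<^term>\<open>vector_derivative\<close> is a total function, so \<open>nderiv_on\<close> is meaningful only where
  the differentiability in \<open>smooth_curve_on\<close> holds.
\<close>

definition nderiv_on :: "nat \<Rightarrow> real set \<Rightarrow> (real \<Rightarrow> real^2) \<Rightarrow> real \<Rightarrow> real^2" where
  "nderiv_on n S \<gamma> = ((\<lambda>f t. vector_derivative f (at t within S)) ^^ n) \<gamma>"

definition smooth_curve_on :: "real set \<Rightarrow> (real \<Rightarrow> real^2) \<Rightarrow> bool" where
  "smooth_curve_on S \<gamma> \<longleftrightarrow>
     (\<forall>n. \<forall>t\<in>S. nderiv_on n S \<gamma> differentiable (at t within S))"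

definition arclength_parametrized_on :: "real set \<Rightarrow> (real \<Rightarrow> real^2) \<Rightarrow> bool" where
  "arclength_parametrized_on S \<gamma> \<longleftrightarrow> (\<forall>t\<in>S. norm (nderiv_on 1 S \<gamma> t) = 1)"

definition x_axis :: "(real^2) set" where
  "x_axis = {p. p $ 2 = 0}"

text \<open>
  The \<open>\<infinity>\<close>-jet of \<open>\<gamma>\<close> at \<open>t\<close> is that of the rightward unit-speed parametrization
  \<open>s \<mapsto> (a + (s - t), 0)\<close> of the \<open>x\<close>-axis at \<open>s = t\<close>.
\<close>

definition x_axis_jet_at :: "real set \<Rightarrow> (real \<Rightarrow> real^2) \<Rightarrow> real \<Rightarrow> real \<Rightarrow> bool" where
  "x_axis_jet_at S \<gamma> t a \<longleftrightarrow>
     \<gamma> t = vector [a, 0] \<and>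
     nderiv_on 1 S \<gamma> t = vector [1, 0] \<and>
     (\<forall>n\<ge>2. nderiv_on n S \<gamma> t = 0)"

definition front_track :: "real set \<Rightarrow> (real \<Rightarrow> real^2) \<Rightarrow> real \<Rightarrow> real^2" where
  "front_track S \<gamma> t = \<gamma> t + nderiv_on 1 S \<gamma> t"

definition axis_intersections :: "real \<Rightarrow> (real \<Rightarrow> real^2) \<Rightarrow> enat" where
  "axis_intersections L c =
     (let P = {t \<in> {0<..<L}. c t \<in> x_axis} in if finite P then enat (card P) else \<infinity>)"

end

theory Submission
  imports Defs
begin

text \<open>
  Let \<open>y\<close> be the second coordinate of \<open>\<gamma>\<close>. The second coordinate of \<open>\<Gamma>\<close> is \<open>y + y'\<close>, and
  \<open>e\<^sup>t (y + y')\<close> is the derivative of \<open>e\<^sup>t y\<close>. The function \<open>e\<^sup>t y\<close> vanishes at the \<open>Z(\<gamma>)\<close>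
  interior zeros of \<open>y\<close> and at both endpoints, so Rolle's theorem gives \<open>Z(\<gamma>) + 1\<close> zeros of its
  derivative.
\<close>

text \<open>Induction inserting elements in increasing order: each new maximum \<open>b\<close>
  contributes one point of \<open>D\<close> between the old maximum and \<open>b\<close>. The bound
  by \<open>Max A\<close> strengthens the induction, since it shows that this point is not yet in
  \<open>B\<close>.\<close>

lemma interlacing_set_exists:
  fixes A :: "'a::linorder set"
  assumes "finite A" "A \<noteq> {}"
    and "\<And>x y. x \<in> A \<Longrightarrow> y \<in> A \<Longrightarrow> x < y \<Longrightarrow> \<exists>z\<in>D. x < z \<and> z < y"
  shows "\<exists>B\<subseteq>D. finite B \<and> card A = Suc (card B) \<and> (\<forall>z\<in>B. z < Max A)"
  using assms
proof (induction rule: finite_linorder_max_induct)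
  case empty
  then show ?case by simp
next
  case (insert b A)
  show ?case
  proof (cases "A = {}")
    case True
    then show ?thesis by (intro exI[of _ "{}"]) simp
  next
    case False
    with insert obtain B where B: "B \<subseteq> D" "finite B" "card A = Suc (card B)" "\<forall>z\<in>B. z < Max A"
      using insert.IH[OF False insert.prems(2)] by auto
    have "Max A \<in> A" using insert.hyps(1) False by simp
    then obtain z where z: "z \<in> D" "Max A < z" "z < b"
      using insert.prems(2)[of "Max A" b] insert.hyps(2) by auto
    have "z \<notin> B" using B(4) z(2) by (auto dest: less_asym)
    moreover have "b \<notin> A" using insert.hyps(2) by blast
    moreover have "Max (insert b A) = b"
      using insert.hyps by (intro Max_eqI) (auto intro: less_imp_le)
    ultimately show ?thesis
      using B z insert.hyps(1) by (intro exI[of _ "insert z B"]) (auto intro: less_trans)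
  qed
qed

lemma Rolle_add_deriv:
  fixes f f' :: "real \<Rightarrow> real"
  assumes "a < b" "f a = 0" "f b = 0"
    and deriv: "\<And>t. t \<in> {a..b} \<Longrightarrow> (f has_real_derivative f' t) (at t within {a..b})"
  shows "\<exists>t. a < t \<and> t < b \<and> f t + f' t = 0"
proof -
  define g where "g t = exp t * f t" for t
  have g: "(g has_real_derivative exp t * (f t + f' t)) (at t within {a..b})"
    if "t \<in> {a..b}" for t
    unfolding g_def
    by (rule derivative_eq_intros deriv that refl)+ (simp add: algebra_simps)
  have "continuous_on {a..b} g"
    by (rule DERIV_continuous_on[OF g])
  \<comment> \<open>At interior points the derivative within \<open>{a..b}\<close> is two-sided, as
    Rolle's theorem requires; at the endpoints continuity suffices.\<close>
  moreover have "(g has_derivative (*) (exp t * (f t + f' t))) (at t)" if "a < t" "t < b" for t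
    using g[of t] that at_within_Icc_at[of a t b] by (simp add: has_field_derivative_def)
  ultimately obtain t where t: "a < t" "t < b" "(*) (exp t * (f t + f' t)) = (\<lambda>v. 0)"
    using Rolle_deriv[of a b g "\<lambda>t. (*) (exp t * (f t + f' t))"] assms by (auto simp: g_def)
  \<comment> \<open>Evaluate the vanishing linear map at 1 and cancel the nonzero factor
    \<open>exp t\<close>.\<close>
  have "f t + f' t = 0"
    using fun_cong[OF t(3), of 1] by simp
  with t(1,2) show ?thesis by blast
qed

theorem proposition5p2:
  fixes L :: real and \<gamma> :: "real \<Rightarrow> real^2"
  assumes "0 < L"
    and "smooth_curve_on {0..L} \<gamma>"
    and "arclength_parametrized_on {0..L} \<gamma>"
    and "x_axis_jet_at {0..L} \<gamma> 0 0"
    and "x_axis_jet_at {0..L} \<gamma> L 1"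
    and "axis_intersections L \<gamma> \<noteq> \<infinity>"
  shows "axis_intersections L (front_track {0..L} \<gamma>) > axis_intersections L \<gamma>"
proof -
  define P where "P = {t \<in> {0<..<L}. \<gamma> t \<in> x_axis}"
  define Q where "Q = {t \<in> {0<..<L}. front_track {0..L} \<gamma> t \<in> x_axis}"
  define y where "y t = \<gamma> t $ 2" for t
  define y' where "y' t = nderiv_on 1 {0..L} \<gamma> t $ 2" for t
  have finP: "finite P" and Z: "axis_intersections L \<gamma> = enat (card P)"
    using assms(6) by (auto simp: axis_intersections_def P_def Let_def split: if_splits)
  have deriv: "(y has_real_derivative y' t) (at t within {0..L})" if "t \<in> {0..L}" for t
  proof -
    \<comment> \<open>Order 0 of smoothness makes the total function
      \<open>vector_derivative\<close> the genuine derivative of \<gamma>.\<close>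
    have "nderiv_on 0 {0..L} \<gamma> differentiable (at t within {0..L})"
      using assms(2) that by (auto simp: smooth_curve_on_def)
    then have "(\<gamma> has_vector_derivative nderiv_on 1 {0..L} \<gamma> t) (at t within {0..L})"
      by (simp add: nderiv_on_def vector_derivative_works)
    then have "(y has_vector_derivative y' t) (at t within {0..L})"
      unfolding y_def y'_def
      by (rule bounded_linear.has_vector_derivative[OF bounded_linear_vec_nth])
    then show ?thesis
      by (simp add: has_real_derivative_iff_has_vector_derivative)
  qed
  have Q_between: "\<exists>t\<in>Q. u < t \<and> t < v"
    if "u \<in> insert 0 (insert L P)" "v \<in> insert 0 (insert L P)" "u < v" for u v
  proof -
    have sub: "{u..v} \<subseteq> {0..L}" using that assms(1) by (auto simp: P_def)
    have "y 0 = 0" "y L = 0"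
      using assms(4,5) by (auto simp: x_axis_jet_at_def y_def)
    then have "y u = 0" "y v = 0"
      using that by (auto simp: P_def x_axis_def y_def)
    moreover have "(y has_real_derivative y' t) (at t within {u..v})" if "t \<in> {u..v}" for t
      using deriv sub that by (meson DERIV_subset subsetD)
    ultimately obtain t where "u < t" "t < v" "y t + y' t = 0"
      using Rolle_add_deriv[of u v y y'] \<open>u < v\<close> by auto
    \<comment> \<open>With the strict bounds \<open>u < t < v\<close> this puts \<open>t\<close> in
      the open interval, as membership in \<open>Q\<close> demands, even when \<open>u\<close> or
      \<open>v\<close> is an endpoint.\<close>
    moreover have "0 \<le> u" "v \<le> L" using sub \<open>u < v\<close> by auto
    ultimately show ?thesis
      by (intro bexI[of _ t]) (auto simp: Q_def x_axis_def front_track_def y_def y'_def)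
  qed
  \<comment> \<open>The endpoints are distinct and lie outside \<open>P\<close>. They add two zeros
    and interlacing loses one, a net gain of one.\<close>
  have "card (insert 0 (insert L P)) = Suc (Suc (card P))"
    using finP assms(1) by (auto simp: P_def)
  moreover have "\<exists>B\<subseteq>Q. finite B \<and> card (insert 0 (insert L P)) = Suc (card B) \<and>
      (\<forall>t\<in>B. t < Max (insert 0 (insert L P)))"
    using finP Q_between by (intro interlacing_set_exists) simp_all
  ultimately obtain B where "B \<subseteq> Q" "card B = Suc (card P)"
    by auto
  \<comment> \<open>If \<open>Q\<close> is infinite, its count is \<infinity> and exceeds
    \<open>card P\<close> anyway.\<close>
  then have "card P < card Q" if "finite Q"
    using card_mono[OF that, of B] by simp
  then have "enat (card P) < axis_intersections L (front_track {0..L} \<gamma>)"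
    by (simp only: axis_intersections_def Let_def Q_def[symmetric]) simp
  then show ?thesis by (simp add: Z)
qed

end
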